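(* There exist constants $C,p>0$ such that for all integers $n\ge 2$, $$\alpha(n)<\frac{C}{(\log n)^{p}}.$$
   Context: For integers $n\ge1$ and $1\le j,k\le n$, let $P^n_{j,k}=\{(x,y)\in\mathbb{R}^2: j-1\le nx-(k-j)y\le j,\ y\in[0,1]\}$, the parallelogram with parallel sides $[(j-1)/n,j/n]\times\{0\}$ and $[(k-1)/n,k/n]\times\{1\}$. For a permutation $\sigma\in\mathrm{Sym}(n)$ of $\{1,\dots,n\}$, let $T^n_\sigma=\bigcup_{j=1}^n P^n_{j,\sigma(j)}$. Define $\alpha(n)=\min_{\sigma\in\mathrm{Sym}(n)}\mu_2(T^n_\sigma)$, where $\mu_2$ is two-dimensional Lebesgue measure on $\mathbb{R}^2$. *)

theory Defs
  imports "HOL-Analysis.Analysis" "HOL-Combinatorics.Permutations"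
begin

definition parallelogram :: "nat \<Rightarrow> nat \<Rightarrow> nat \<Rightarrow> (real \<times> real) set" where
  "parallelogram n j k =
     {(x, y). real j - 1 \<le> real n * x - (real k - real j) * y
            \<and> real n * x - (real k - real j) * y \<le> real j
            \<and> y \<in> {0..1}}"

definition perm_union :: "nat \<Rightarrow> (nat \<Rightarrow> nat) \<Rightarrow> (real \<times> real) set" where
  "perm_union n \<sigma> = (\<Union>j\<in>{1..n}. parallelogram n j (\<sigma> j))"

definition alpha :: "nat \<Rightarrow> real" where
  "alpha n = Min ((\<lambda>\<sigma>. measure lebesgue (perm_union n \<sigma>)) ` {\<sigma>. \<sigma> permutes {1..n}})"

(* The next lemmas show that the junk values of measure (on non-measurable or infinite-measure
   sets) and of Min (on infinite or empty sets) do not arise in alpha n for n \<ge> 1. *)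

lemma compact_parallelogram:
  assumes "n \<ge> 1"
  shows "compact (parallelogram n j k)"
proof -
  have eq: "parallelogram n j k =
      (\<lambda>(u, y). ((u + (real k - real j) * y) / real n, y)) ` ({real j - 1..real j} \<times> {0..1})"
    (is "_ = ?f ` ?R")
  proof
    show "parallelogram n j k \<subseteq> ?f ` ?R"
    proof
      fix z assume z: "z \<in> parallelogram n j k"
      obtain x y where xy: "z = (x, y)" by (cases z)
      have "z = ?f (real n * x - (real k - real j) * y, y)"
        using assms by (simp add: xy)
      moreover have "(real n * x - (real k - real j) * y, y) \<in> ?R"
        using z by (simp add: xy parallelogram_def)
      ultimately show "z \<in> ?f ` ?R" by (rule image_eqI)
    qed
    show "?f ` ?R \<subseteq> parallelogram n j k"
      using assms by (auto simp: parallelogram_def)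
  qed
  have "continuous_on ?R ?f"
    using assms by (auto simp: case_prod_unfold intro!: continuous_intros)
  then show ?thesis
    unfolding eq by (intro compact_continuous_image compact_Times) auto
qed

lemma perm_union_lmeasurable:
  assumes "n \<ge> 1"
  shows "perm_union n \<sigma> \<in> lmeasurable"
proof -
  have "compact (perm_union n \<sigma>)"
    unfolding perm_union_def using assms by (intro compact_UN compact_parallelogram) auto
  then show ?thesis by (rule lmeasurable_compact)
qed

lemma finite_perms: "finite {\<sigma>. \<sigma> permutes {1..n::nat}}"
  by (simp add: finite_permutations)

lemma perms_nonempty: "{\<sigma>. \<sigma> permutes {1..n::nat}} \<noteq> {}"
  using permutes_id by blast

end

theory Submission
  imports Defs
begin

text \<open>
A permutation with small union is built by refinement. Let \<open>\<sigma>\<close> be a permutation of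
\<open>m\<close> indices whose figure has area \<open>a\<close>. Replacing each of the \<open>N\<close> large parallelograms of an
outer permutation \<open>\<pi>\<close> by a squeezed copy of this figure yields the figure of a permutation of
\<open>N * m\<close> indices: a union of \<open>N\<close> sets of area \<open>a / N\<close>. Its area is again at most \<open>a\<close>, and
it is smaller as soon as these sets overlap.

Overlaps are forced by taking \<open>\<pi>\<close> at random. All \<open>N\<^sup>2\<close> copies \<open>F j k\<close>, from
block \<open>j\<close> to block \<open>k\<close>, lie in the unit square and have total area \<open>N * a\<close>. So by Cauchy-Schwarz the
integral of the squared number of copies at a point is at least \<open>(N * a)\<^sup>2\<close>, wherever the
copies are. Few of the pairs counted there share \<open>j\<close> or \<open>k\<close>, provided that the height
stays away from 0 and 1, and every other pair is contained in the random union with the same probability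
\<open>1 / (N * (N - 1))\<close>. Hence some \<open>\<pi>\<close> lowers the area from \<open>a\<close> to about
\<open>a - a\<^sup>2 / N\<close>: the averaging is \<open>exists_permutation_small_union\<close>, and
\<open>exists_refinement_smaller_strip_area\<close> is its geometric form.

With \<open>N\<close> a suitable multiple of \<open>\<epsilon> powr -2\<close>, iteration brings the area below a multiple of
\<open>\<epsilon>\<close> at some size whose logarithm is at most a constant times \<open>\<epsilon> powr -6\<close>
(\<open>exists_small_strip_area\<close>). Any much larger size \<open>n\<close> inherits the bound by placing copies side by
side (\<open>alpha_le_of_smaller_perm\<close>). Solving for \<open>\<epsilon>\<close> in terms of \<open>n\<close> gives the
exponent \<open>1 / 6\<close>.
\<close>

section \<open>Random permutations\<close>

lemma ex_permutes_two_points: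
  assumes "k \<in> S" "k' \<in> S" "l \<in> S" "l' \<in> S" "k \<noteq> k'" "l \<noteq> l'"
  obtains \<tau> where "\<tau> permutes S" "\<tau> k = l" "\<tau> k' = l'"
proof
  let ?m = "Transposition.transpose k l k'"
  let ?t = "Transposition.transpose ?m l' \<circ> Transposition.transpose k l"
  have m: "?m \<in> S" "?m \<noteq> l"
    using assms by (auto simp: Transposition.transpose_def)
  show "?t permutes S"
    using assms m by (intro permutes_compose permutes_swap_id) auto
  show "?t k = l" "?t k' = l'"
    using assms m by (auto simp: Transposition.transpose_def)
qed

text \<open>
Left multiplication by a permutation moving \<open>(k, k')\<close> to \<open>(l, l')\<close> carries one of these
sets onto another, so the \<open>N * (N - 1)\<close> sets that partition all permutations have equal size.
\<close>

lemma card_permutes_two_values: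
  fixes S :: "'a set"
  assumes S: "finite S" and j: "j \<in> S" "j' \<in> S" "j \<noteq> j'"
    and k: "k \<in> S" "k' \<in> S" "k \<noteq> k'"
  shows "card {\<pi>. \<pi> permutes S \<and> \<pi> j = k \<and> \<pi> j' = k'} * (card S * (card S - 1)) = fact (card S)"
proof -
  let ?C = "\<lambda>(l, l'). {\<pi>. \<pi> permutes S \<and> \<pi> j = l \<and> \<pi> j' = l'}"
  let ?I = "SIGMA l:S. S - {l}"
  have fin: "finite {\<pi>. \<pi> permutes S}"
    using S by (rule finite_permutations)
  have same: "card (?C (l, l')) = card (?C (k, k'))" if "(l, l') \<in> ?I" for l l'
  proof -
    from that have l: "l \<in> S" "l' \<in> S" "l \<noteq> l'" by auto
    obtain \<tau> where \<tau>: "\<tau> permutes S" "\<tau> k = l" "\<tau> k' = l'"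
      using ex_permutes_two_points[of k S k' l l'] k l by blast
    have inv: "inv \<tau> permutes S" "inv \<tau> l = k" "inv \<tau> l' = k'"
      using \<tau> by (auto simp: permutes_inv permutes_inv_eq)
    have "bij_betw (\<lambda>\<pi>. \<tau> \<circ> \<pi>) (?C (k, k')) (?C (l, l'))"
      using \<tau> inv
      by (intro bij_betw_byWitness[where f' = "\<lambda>\<pi>. inv \<tau> \<circ> \<pi>"])
         (auto simp: permutes_compose fun_eq_iff permutes_inverses[OF \<tau>(1)])
    then show ?thesis by (simp add: bij_betw_same_card)
  qed
  have "{\<pi>. \<pi> permutes S} = (\<Union>p\<in>?I. ?C p)"
    using j by (auto simp: permutes_in_image inj_eq[OF permutes_inj])
  then have "fact (card S) = card (\<Union>p\<in>?I. ?C p)"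
    using card_permutations[OF refl S] by simp
  also have "\<dots> = (\<Sum>p\<in>?I. card (?C p))"
    using S fin by (intro card_UN_disjoint ballI finite_subset[OF _ fin]) auto
  also have "\<dots> = card ?I * card (?C (k, k'))"
  proof -
    have "(\<Sum>p\<in>?I. card (?C p)) = (\<Sum>p\<in>?I. card (?C (k, k')))"
    proof (rule sum.cong)
      fix p assume "p \<in> ?I"
      then show "card (?C p) = card (?C (k, k'))"
        using same[of "fst p" "snd p"] by (simp only: prod.collapse)
    qed simp
    then show ?thesis by simp
  qed
  also have "card ?I = card S * (card S - 1)"
    using S by simp
  finally show ?thesis by simp
qed

lemma card_permutes_one_value:
  fixes S :: "'a set"
  assumes S: "finite S" and j: "j \<in> S" and k: "k \<in> S"
  shows "card {\<pi>. \<pi> permutes S \<and> \<pi> j = k} * card S = fact (card S)"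
proof -
  let ?C = "\<lambda>l. {\<pi>. \<pi> permutes S \<and> \<pi> j = l}"
  have fin: "finite {\<pi>. \<pi> permutes S}"
    using S by (rule finite_permutations)
  have same: "card (?C l) = card (?C k)" if "l \<in> S" for l
  proof -
    let ?t = "Transposition.transpose k l"
    have "?t permutes S"
      using k that by (rule permutes_swap_id)
    then have "bij_betw (\<lambda>\<pi>. ?t \<circ> \<pi>) (?C k) (?C l)"
      by (intro bij_betw_byWitness[where f' = "\<lambda>\<pi>. ?t \<circ> \<pi>"])
         (auto simp: permutes_compose fun_eq_iff)
    then show ?thesis by (simp add: bij_betw_same_card)
  qed
  have "{\<pi>. \<pi> permutes S} = (\<Union>l\<in>S. ?C l)"
    using j by (auto simp: permutes_in_image)
  then have "fact (card S) = card (\<Union>l\<in>S. ?C l)"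
    using card_permutations[OF refl S] by simp
  also have "\<dots> = (\<Sum>l\<in>S. card (?C l))"
    using S fin by (intro card_UN_disjoint ballI finite_subset[OF _ fin]) auto
  also have "\<dots> = card S * card (?C k)"
    using same by simp
  finally show ?thesis by simp
qed

lemma sum_permutes_one_value:
  fixes f :: "'a \<Rightarrow> real"
  assumes S: "finite S" and j: "j \<in> S"
  shows "(\<Sum>\<pi> | \<pi> permutes S. f (\<pi> j)) = fact (card S) / card S * (\<Sum>k\<in>S. f k)"
proof -
  have fin: "finite {\<pi>. \<pi> permutes S}"
    using S by (rule finite_permutations)
  have "(\<Sum>\<pi> | \<pi> permutes S. f (\<pi> j)) =
      (\<Sum>k\<in>S. \<Sum>\<pi> | \<pi> \<in> {\<pi>. \<pi> permutes S} \<and> \<pi> j = k. f (\<pi> j))"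
    using S j by (intro sum.group[symmetric] fin) (auto simp: permutes_in_image)
  also have "\<dots> = (\<Sum>k\<in>S. fact (card S) / card S * f k)"
  proof (rule sum.cong)
    fix k assume "k \<in> S"
    from card_permutes_one_value[OF S j this]
    have "real (card {\<pi>. \<pi> permutes S \<and> \<pi> j = k}) * card S = fact (card S)"
      by (simp only: of_nat_fact flip: of_nat_mult)
    moreover have "card S > 0" using S j by (auto simp: card_gt_0_iff)
    ultimately have c: "real (card {\<pi>. \<pi> permutes S \<and> \<pi> j = k}) = fact (card S) / card S"
      by (simp add: field_simps)
    show "(\<Sum>\<pi> | \<pi> \<in> {\<pi>. \<pi> permutes S} \<and> \<pi> j = k. f (\<pi> j)) = fact (card S) / card S * f k"
      by (simp flip: c)
  qed simp
  finally show ?thesis by (simp add: sum_distrib_left)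
qed

lemma sum_permutes_two_values:
  fixes f :: "'a \<Rightarrow> 'a \<Rightarrow> real"
  assumes S: "finite S" and j: "j \<in> S" "j' \<in> S" "j \<noteq> j'"
  shows "(\<Sum>\<pi> | \<pi> permutes S. f (\<pi> j) (\<pi> j')) =
    fact (card S) / (card S * (card S - 1)) * (\<Sum>k\<in>S. \<Sum>k'\<in>S - {k}. f k k')"
proof -
  let ?I = "SIGMA k:S. S - {k}"
  have fin: "finite {\<pi>. \<pi> permutes S}"
    using S by (rule finite_permutations)
  have "card {j, j'} \<le> card S"
    using S j by (intro card_mono) auto
  then have N: "card S \<ge> 2" using j by simp
  have "(\<Sum>\<pi> | \<pi> permutes S. f (\<pi> j) (\<pi> j')) =
      (\<Sum>p\<in>?I. \<Sum>\<pi> | \<pi> \<in> {\<pi>. \<pi> permutes S} \<and> (\<pi> j, \<pi> j') = p. f (\<pi> j) (\<pi> j'))"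
    using S j by (intro sum.group[symmetric] fin)
      (auto simp: permutes_in_image inj_eq[OF permutes_inj])
  also have "\<dots> = (\<Sum>(k, k')\<in>?I. fact (card S) / (card S * (card S - 1)) * f k k')"
  proof (rule sum.cong)
    fix p assume "p \<in> ?I"
    then obtain k k' where p: "p = (k, k')" and k: "k \<in> S" "k' \<in> S" "k \<noteq> k'" by auto
    from card_permutes_two_values[OF S j k]
    have "real (card {\<pi>. \<pi> permutes S \<and> \<pi> j = k \<and> \<pi> j' = k'}) * real (card S * (card S - 1))
        = fact (card S)"
      by (simp only: of_nat_fact flip: of_nat_mult)
    moreover have "real (card S * (card S - 1)) > 0" using N by simp
    ultimately have c: "real (card {\<pi>. \<pi> permutes S \<and> \<pi> j = k \<and> \<pi> j' = k'})
        = fact (card S) / real (card S * (card S - 1))"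
      by (intro eq_divide_imp) (simp_all del: of_nat_mult)
    show "(\<Sum>\<pi> | \<pi> \<in> {\<pi>. \<pi> permutes S} \<and> (\<pi> j, \<pi> j') = p. f (\<pi> j) (\<pi> j')) =
        (case p of (k, k') \<Rightarrow> fact (card S) / (card S * (card S - 1)) * f k k')"
      using c by (simp add: p)
  qed simp
  also have "\<dots> = (\<Sum>k\<in>S. \<Sum>k'\<in>S - {k}. fact (card S) / (card S * (card S - 1)) * f k k')"
    using S by (subst sum.Sigma) auto
  finally show ?thesis by (simp only: sum_distrib_left)
qed

text \<open>
Regard \<open>G\<close> as the cells of a square board and a permutation as a placement of non-attacking rooks.
The number \<open>Z\<close> of rooks on \<open>G\<close> satisfies \<open>1[Z > 0] \<le> Z - Z (Z - 1) / N\<close>,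
because \<open>Z \<le> N\<close>. The mean of \<open>Z\<close> is \<open>card G / N\<close>. The mean of
\<open>Z (Z - 1)\<close> is the number of pairs of cells of \<open>G\<close> in different rows and columns, divided by
\<open>N * (N - 1)\<close>; these are all \<open>(card G)\<^sup>2\<close> pairs but for at most
\<open>2 * D * card G\<close>.
\<close>

lemma sum_permutes_meets_le:
  fixes G :: "('a \<times> 'a) set" and D :: real
  assumes S: "finite S" "card S \<ge> 2" and G: "G \<subseteq> S \<times> S"
    and row: "\<And>j. j \<in> S \<Longrightarrow> card {k. (j, k) \<in> G} \<le> D"
    and col: "\<And>k. k \<in> S \<Longrightarrow> card {j. (j, k) \<in> G} \<le> D"
  shows "(\<Sum>\<pi> | \<pi> permutes S. of_bool (\<exists>j\<in>S. (j, \<pi> j) \<in> G)) \<le>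
    fact (card S) * (card G / card S - ((real (card G))\<^sup>2 - 2 * D * card G) / real (card S) ^ 3)"
proof -
  define N where "N = card S"
  define h where "h j k = (of_bool ((j, k) \<in> G) :: real)" for j k
  define Z where "Z \<pi> = (\<Sum>j\<in>S. h j (\<pi> j))" for \<pi> :: "'a \<Rightarrow> 'a"
  define Q where "Q \<pi> = (\<Sum>j\<in>S. \<Sum>j'\<in>S - {j}. h j (\<pi> j) * h j' (\<pi> j'))" for \<pi> :: "'a \<Rightarrow> 'a"
  define s where "s = real (card G)"
  define T where "T = (\<Sum>j\<in>S. \<Sum>j'\<in>S - {j}. \<Sum>k\<in>S. \<Sum>k'\<in>S - {k}. h j k * h j' k')"
  have N: "real N \<ge> 2" using S by (simp add: N_def)
  have h01: "h j k \<in> {0, 1}" "0 \<le> h j k" "h j k \<le> 1" "h j k * h j k = h j k" for j k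
    by (auto simp: h_def)
  have s: "s = (\<Sum>j\<in>S. \<Sum>k\<in>S. h j k)"
  proof -
    have "s = (\<Sum>p\<in>S \<times> S. of_bool (p \<in> G))"
      using S G by (simp add: s_def sum.If_cases of_bool_def Int_absorb2 Int_absorb1)
    also have "\<dots> = (\<Sum>j\<in>S. \<Sum>k\<in>S. h j k)"
      by (simp add: h_def sum.cartesian_product split_def)
    finally show ?thesis .
  qed
  \<comment> \<open>For \<open>Z \<ge> 1\<close> this is \<open>Z (Z - 1) \<le> N (Z - 1)\<close>; \<open>Q\<close> is \<open>Z (Z - 1)\<close> written as a sum over pairs.\<close>
  have bonferroni: "of_bool (\<exists>j\<in>S. (j, \<pi> j) \<in> G) \<le> Z \<pi> - Q \<pi> / N" for \<pi>
  proof -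
    have Z: "Z \<pi> = card {j\<in>S. (j, \<pi> j) \<in> G}"
      using S by (simp add: Z_def h_def sum.If_cases of_bool_def Int_def)
    have ZN: "Z \<pi> \<le> N"
      using S unfolding Z N_def by (simp add: card_mono)
    have ZZ: "Z \<pi> * Z \<pi> = Z \<pi> + Q \<pi>"
    proof -
      have "Z \<pi> * Z \<pi> = (\<Sum>j\<in>S. \<Sum>j'\<in>S. h j (\<pi> j) * h j' (\<pi> j'))"
        by (simp add: Z_def sum_product)
      also have "\<dots> = (\<Sum>j\<in>S. h j (\<pi> j) * h j (\<pi> j) + (\<Sum>j'\<in>S - {j}. h j (\<pi> j) * h j' (\<pi> j')))"
        using S by (intro sum.cong refl sum.remove) auto
      also have "\<dots> = Z \<pi> + Q \<pi>"
        by (simp add: Z_def Q_def h01(4) sum.distrib)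
      finally show ?thesis .
    qed
    show ?thesis
    proof (cases "\<exists>j\<in>S. (j, \<pi> j) \<in> G")
      case True
      then have "card {j\<in>S. (j, \<pi> j) \<in> G} > 0"
        using S by (auto simp: card_gt_0_iff)
      then have Z1: "Z \<pi> \<ge> 1" using Z by simp
      have "Q \<pi> = Z \<pi> * (Z \<pi> - 1)" using ZZ by (simp add: algebra_simps)
      also have "\<dots> \<le> N * (Z \<pi> - 1)" using ZN Z1 by (intro mult_right_mono) auto
      finally have "Q \<pi> / N \<le> Z \<pi> - 1" using N by (simp add: field_simps)
      then show ?thesis using True by simp
    next
      case False
      then have "Z \<pi> = 0" by (auto simp: Z_def h_def)
      then show ?thesis using ZZ False by simp
    qed
  qed
  have sumZ: "(\<Sum>\<pi> | \<pi> permutes S. Z \<pi>) = fact N / N * s"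
  proof -
    have "(\<Sum>\<pi> | \<pi> permutes S. Z \<pi>) = (\<Sum>j\<in>S. \<Sum>\<pi> | \<pi> permutes S. h j (\<pi> j))"
      unfolding Z_def by (rule sum.swap)
    also have "\<dots> = (\<Sum>j\<in>S. fact N / N * (\<Sum>k\<in>S. h j k))"
      using S by (intro sum.cong refl) (simp add: sum_permutes_one_value N_def)
    finally show ?thesis by (simp add: s sum_distrib_left)
  qed
  have sumQ: "(\<Sum>\<pi> | \<pi> permutes S. Q \<pi>) = fact N / (N * (N - 1)) * T"
  proof -
    have "(\<Sum>\<pi> | \<pi> permutes S. Q \<pi>) =
        (\<Sum>j\<in>S. \<Sum>\<pi> | \<pi> permutes S. \<Sum>j'\<in>S - {j}. h j (\<pi> j) * h j' (\<pi> j'))"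
      unfolding Q_def by (rule sum.swap)
    also have "\<dots> = (\<Sum>j\<in>S. \<Sum>j'\<in>S - {j}. \<Sum>\<pi> | \<pi> permutes S. h j (\<pi> j) * h j' (\<pi> j'))"
      by (intro sum.cong refl sum.swap)
    also have "\<dots> = (\<Sum>j\<in>S. \<Sum>j'\<in>S - {j}. fact N / (N * (N - 1)) *
        (\<Sum>k\<in>S. \<Sum>k'\<in>S - {k}. h j k * h j' k'))"
      unfolding N_def
      using S by (intro sum.cong refl sum_permutes_two_values) auto
    finally show ?thesis by (simp only: T_def sum_distrib_left)
  qed
  have T0: "T \<ge> 0" unfolding T_def by (intro sum_nonneg mult_nonneg_nonneg h01)
  have T: "T \<ge> s\<^sup>2 - 2 * D * s"
  proof -
    have "s\<^sup>2 - 2 * D * s = (\<Sum>j\<in>S. \<Sum>k\<in>S. h j k * (s - 2 * D))"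
      unfolding sum_distrib_right[symmetric] s[symmetric]
      by (simp add: power2_eq_square algebra_simps)
    also have "\<dots> \<le> (\<Sum>j\<in>S. \<Sum>k\<in>S. h j k * (\<Sum>j'\<in>S - {j}. \<Sum>k'\<in>S - {k}. h j' k'))"
    proof (intro sum_mono mult_left_mono h01)
      fix j k assume j: "j \<in> S" and k: "k \<in> S"
      have r: "(\<Sum>k\<in>S. h j k) \<le> D"
      proof -
        have "(\<Sum>k\<in>S. h j k) = card {k. (j, k) \<in> G}"
          using S G by (auto simp: h_def sum.If_cases of_bool_def intro!: arg_cong[where f=card])
        then show ?thesis using row[OF j] by simp
      qed
      have c: "(\<Sum>j\<in>S. h j k) \<le> D"
      proof -
        have "(\<Sum>j\<in>S. h j k) = card {j. (j, k) \<in> G}"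
          using S G by (auto simp: h_def sum.If_cases of_bool_def intro!: arg_cong[where f=card])
        then show ?thesis using col[OF k] by simp
      qed
      have "s = (\<Sum>k\<in>S. h j k) + (\<Sum>j'\<in>S - {j}. \<Sum>k'\<in>S. h j' k')"
        unfolding s using S j by (intro sum.remove) auto
      also have "(\<Sum>j'\<in>S - {j}. \<Sum>k'\<in>S. h j' k') =
          (\<Sum>j'\<in>S - {j}. h j' k) + (\<Sum>j'\<in>S - {j}. \<Sum>k'\<in>S - {k}. h j' k')"
        unfolding sum.distrib[symmetric] using S k by (intro sum.cong refl sum.remove) auto
      also have "(\<Sum>j'\<in>S - {j}. h j' k) \<le> (\<Sum>j'\<in>S. h j' k)"
        using S h01 by (intro sum_mono2) auto
      finally show "s - 2 * D \<le> (\<Sum>j'\<in>S - {j}. \<Sum>k'\<in>S - {k}. h j' k')"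
        using r c by simp
    qed
    also have "\<dots> = (\<Sum>j\<in>S. \<Sum>k\<in>S. \<Sum>j'\<in>S - {j}. \<Sum>k'\<in>S - {k}. h j k * h j' k')"
      by (simp only: sum_distrib_left)
    also have "\<dots> = T"
      unfolding T_def by (intro sum.cong refl sum.swap)
    finally show ?thesis .
  qed
  \<comment> \<open>The lower bound for \<open>T\<close> may be negative, so \<open>N * (N - 1)\<close> is replaced by \<open>N * N\<close>
      on the nonnegative number \<open>T\<close> only.\<close>
  have "(s\<^sup>2 - 2 * D * s) / N ^ 3 \<le> T / N ^ 3"
    using T by (intro divide_right_mono) auto
  also have "\<dots> \<le> T / (N * (N - 1) * N)"
  proof (rule divide_left_mono)
    show "real (N * (N - 1) * N) \<le> real (N ^ 3)"
      unfolding of_nat_le_iff by (simp add: power3_eq_cube mult_le_mono)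
    show "0 < real (N ^ 3) * real (N * (N - 1) * N)" using N by simp
  qed (fact T0)
  finally have main: "(s\<^sup>2 - 2 * D * s) / N ^ 3 \<le> T / (N * (N - 1) * N)" .
  have "(\<Sum>\<pi> | \<pi> permutes S. of_bool (\<exists>j\<in>S. (j, \<pi> j) \<in> G)) \<le>
      (\<Sum>\<pi> | \<pi> permutes S. Z \<pi> - Q \<pi> / N)"
    by (intro sum_mono bonferroni)
  also have "\<dots> = fact N / N * s - fact N / (N * (N - 1)) * T / N"
    by (simp only: sum_subtractf sumZ sum_divide_distrib[symmetric] sumQ)
  also have "\<dots> = fact N * (s / N - T / (N * (N - 1) * N))"
    by (simp add: algebra_simps)
  also have "\<dots> \<le> fact N * (s / N - (s\<^sup>2 - 2 * D * s) / N ^ 3)"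
    using main by (intro mult_left_mono) auto
  finally show ?thesis by (simp add: N_def s_def)
qed

text \<open>
For every point \<open>x\<close> the previous lemma applies to the cells \<open>(j, k)\<close> with
\<open>x \<in> F j k\<close>. Their number \<open>c x\<close> has mean \<open>N * a\<close>, hence, by Cauchy-Schwarz, second
moment at least \<open>(N * a)\<^sup>2\<close>. This lower bound is what makes the gain of order
\<open>a\<^sup>2\<close> independent of the shape and position of the sets, and it is the reason to average
over all permutations: a single one gives no such information on its overlaps.
\<close>

lemma exists_permutation_small_union:
  fixes F :: "'a \<Rightarrow> 'a \<Rightarrow> 'b set" and a D :: real
  assumes "finite_measure M" and M1: "measure M (space M) = 1"
    and S: "finite S" "card S \<ge> 2"
    and F: "\<And>j k. j \<in> S \<Longrightarrow> k \<in> S \<Longrightarrow> F j k \<in> sets M"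
    and a: "\<And>j k. j \<in> S \<Longrightarrow> k \<in> S \<Longrightarrow> measure M (F j k) = a / card S"
    and row: "\<And>x j. x \<in> space M \<Longrightarrow> j \<in> S \<Longrightarrow> card {k\<in>S. x \<in> F j k} \<le> D"
    and col: "\<And>x k. x \<in> space M \<Longrightarrow> k \<in> S \<Longrightarrow> card {j\<in>S. x \<in> F j k} \<le> D"
  shows "\<exists>\<pi>. \<pi> permutes S \<and>
    measure M (\<Union>j\<in>S. F j (\<pi> j)) \<le> a - (a\<^sup>2 - 2 * D * a / card S) / card S"
proof (rule ccontr)
  interpret finite_measure M by fact
  define N where "N = real (card S)"
  define P where "P = {\<pi>. \<pi> permutes S}"
  define U where "U \<pi> = (\<Union>j\<in>S. F j (\<pi> j))" for \<pi>
  define G where "G x = {(j, k). j \<in> S \<and> k \<in> S \<and> x \<in> F j k}" for x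
  define c where "c x = real (card (G x))" for x
  define b where "b = a - (a\<^sup>2 - 2 * D * a / N) / N"
  assume "\<not> ?thesis"
  then have big: "measure M (U \<pi>) > b" if "\<pi> \<in> P" for \<pi>
    using that by (auto simp: P_def U_def b_def N_def not_le)
  have finP: "finite P" unfolding P_def using S(1) by (rule finite_permutations)
  have cardP: "real (card P) = fact (card S)"
    unfolding P_def using card_permutations[OF refl S(1)] by simp
  have "id \<in> P" by (simp add: P_def permutes_id)
  then have neP: "P \<noteq> {}" by blast
  have N: "N \<ge> 2" using S by (simp add: N_def)
  have U: "U \<pi> \<in> sets M" if "\<pi> \<in> P" for \<pi>
    unfolding U_def using S(1) that
    by (intro sets.finite_UN F) (auto simp: P_def permutes_in_image)
  have c: "c x = (\<Sum>j\<in>S. \<Sum>k\<in>S. indicator (F j k) x)" for x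
  proof -
    have "G x = {p\<in>S \<times> S. x \<in> F (fst p) (snd p)}" by (auto simp: G_def)
    then have "c x = (\<Sum>p\<in>S \<times> S. indicator (F (fst p) (snd p)) x)"
      using S by (simp add: c_def indicator_def sum.If_cases of_bool_def Int_def)
    then show ?thesis by (simp add: sum.cartesian_product split_def)
  qed
  have c_meas[measurable]: "c \<in> borel_measurable M"
    unfolding c[abs_def] by (intro borel_measurable_sum borel_measurable_indicator F)
  have c_bound: "0 \<le> c x" "c x \<le> N * N" for x
  proof -
    have "c x \<le> (\<Sum>j\<in>S. \<Sum>k\<in>S. 1)"
      unfolding c by (intro sum_mono) (auto simp: indicator_def)
    then show "c x \<le> N * N" by (simp add: N_def)
  qed (simp add: c_def)
  have c_int: "integrable M c"
    using c_bound by (intro integrable_const_bound[where B="N * N"]) auto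
  have c2_int: "integrable M (\<lambda>x. (c x)\<^sup>2)"
    using c_bound
    by (intro integrable_const_bound[where B="(N * N)\<^sup>2"]) (auto intro: power_mono)
  have int_c: "integral\<^sup>L M c = N * a"
  proof -
    have "integral\<^sup>L M c = (\<Sum>j\<in>S. \<Sum>k\<in>S. measure M (F j k))"
      unfolding c by (simp add: F Bochner_Integration.integral_sum emeasure_eq_measure)
    also have "\<dots> = N * a" using N by (simp add: a N_def)
    finally show ?thesis .
  qed
  have cauchy: "integral\<^sup>L M (\<lambda>x. (c x)\<^sup>2) \<ge> (N * a)\<^sup>2"
  proof -
    have "0 \<le> integral\<^sup>L M (\<lambda>x. (c x - N * a)\<^sup>2)" by simp
    also have "\<dots> = integral\<^sup>L M (\<lambda>x. (c x)\<^sup>2 - 2 * (N * a) * c x + (N * a)\<^sup>2)"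
      by (simp add: power2_diff algebra_simps)
    also have "\<dots> = integral\<^sup>L M (\<lambda>x. (c x)\<^sup>2) - (N * a)\<^sup>2"
      using c_int c2_int by (simp add: int_c M1 power2_eq_square)
    finally show ?thesis by simp
  qed
  have "fact (card S) * b = (\<Sum>\<pi>\<in>P. b)" by (simp add: cardP)
  also have "\<dots> < (\<Sum>\<pi>\<in>P. measure M (U \<pi>))"
    using finP neP by (intro sum_strict_mono big) auto
  also have "\<dots> = integral\<^sup>L M (\<lambda>x. \<Sum>\<pi>\<in>P. indicator (U \<pi>) x)"
    by (simp add: U Bochner_Integration.integral_sum emeasure_eq_measure)
  also have "\<dots> \<le> integral\<^sup>L M (\<lambda>x. fact (card S) * (c x / N - ((c x)\<^sup>2 - 2 * D * c x) / N ^ 3))"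
  proof (rule integral_mono)
    show "integrable M (\<lambda>x. \<Sum>\<pi>\<in>P. indicator (U \<pi>) x :: real)"
      by (auto simp: U emeasure_eq_measure)
    show "integrable M (\<lambda>x. fact (card S) * (c x / N - ((c x)\<^sup>2 - 2 * D * c x) / N ^ 3))"
      using c_int c2_int by auto
    fix x assume x: "x \<in> space M"
    have "(\<Sum>\<pi>\<in>P. indicator (U \<pi>) x) =
        (\<Sum>\<pi> | \<pi> permutes S. of_bool (\<exists>j\<in>S. (j, \<pi> j) \<in> G x) :: real)"
      unfolding P_def
      by (intro sum.cong refl) (auto simp: U_def G_def indicator_def permutes_in_image)
    also have "\<dots> \<le> fact (card S) * (c x / N - ((c x)\<^sup>2 - 2 * D * c x) / N ^ 3)"
      unfolding c_def N_def
    proof (rule sum_permutes_meets_le[OF S])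
      show "G x \<subseteq> S \<times> S" by (auto simp: G_def)
      show "card {k. (j, k) \<in> G x} \<le> D" if "j \<in> S" for j
        using row[OF x that] that by (simp add: G_def)
      show "card {j. (j, k) \<in> G x} \<le> D" if "k \<in> S" for k
        using col[OF x that] that by (simp add: G_def)
    qed
    finally show "(\<Sum>\<pi>\<in>P. indicator (U \<pi>) x) \<le>
        fact (card S) * (c x / N - ((c x)\<^sup>2 - 2 * D * c x) / N ^ 3)" .
  qed
  also have "\<dots> = fact (card S) * (integral\<^sup>L M c / N -
      (integral\<^sup>L M (\<lambda>x. (c x)\<^sup>2) - 2 * D * integral\<^sup>L M c) / N ^ 3)"
    using c_int c2_int by simp
  also have "\<dots> \<le> fact (card S) * (N * a / N - ((N * a)\<^sup>2 - 2 * D * (N * a)) / N ^ 3)"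
    unfolding int_c using cauchy N
    by (intro mult_left_mono diff_mono divide_right_mono order_refl) auto
  also have "\<dots> = fact (card S) * b"
    using N by (simp add: b_def field_simps power2_eq_square power3_eq_cube)
  finally show False by simp
qed

section \<open>Areas in the plane\<close>

text \<open>
Each horizontal section is translated and divided by \<open>s\<close>; Fubini does the rest. Both the
shearing of a strip to another slope and the shrinking of a block are of this form.
\<close>

lemma measure_fibrewise_affine:
  fixes E :: "(real \<times> real) set" and c :: "real \<Rightarrow> real"
  assumes E[measurable]: "E \<in> sets borel" and s: "s > 0" and c[measurable]: "c \<in> borel_measurable borel"
  shows "{(x, y). (s * x - c y, y) \<in> E} \<in> sets borel" (is "?E \<in> _")
    and "measure lborel {(x, y). (s * x - c y, y) \<in> E} = measure lborel E / s"
proof -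
  have "(\<lambda>p. (s * fst p - c (snd p), snd p)) -` E \<inter> space borel \<in> sets (borel :: (real \<times> real) measure)"
    by (rule measurable_sets[OF _ E]) (simp add: borel_prod[symmetric])
  also have "(\<lambda>p. (s * fst p - c (snd p), snd p)) -` E \<inter> space borel = ?E" by auto
  finally show meas: "?E \<in> sets borel" .
  have E': "E \<in> sets (lborel \<Otimes>\<^sub>M lborel)" "?E \<in> sets (lborel \<Otimes>\<^sub>M lborel)"
    using E meas by (simp_all only: lborel_prod sets_lborel)
  have fibre: "emeasure lborel ((\<lambda>x. (x, y)) -` E) = ennreal s * emeasure lborel ((\<lambda>x. (x, y)) -` ?E)" for y
  proof -
    let ?A = "(\<lambda>x. (x, y)) -` E"
    have A: "?A \<in> sets borel"
      using sets_Pair2[OF E'(1)] by simp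
    have B: "(\<lambda>x. (x, y)) -` ?E \<in> sets borel"
      using sets_Pair2[OF E'(2)] by simp
    have "emeasure lborel ?A = (\<integral>\<^sup>+x. indicator ?A x \<partial>lborel)"
      using A by simp
    also have "\<dots> = \<bar>s\<bar> * (\<integral>\<^sup>+x. indicator ?A (- c y + s * x) \<partial>lborel)"
      using A s by (intro nn_integral_real_affine) auto
    also have "(\<lambda>x. indicator ?A (- c y + s * x) :: ennreal) = indicator ((\<lambda>x. (x, y)) -` ?E)"
      by (auto simp: indicator_def fun_eq_iff)
    finally show ?thesis using B s by simp
  qed
  have "emeasure lborel E = (\<integral>\<^sup>+y. emeasure lborel ((\<lambda>x. (x, y)) -` E) \<partial>lborel)"
    using lborel_pair.emeasure_pair_measure_alt2[OF E'(1)] by (simp add: lborel_prod)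
  also have "\<dots> = ennreal s * (\<integral>\<^sup>+y. emeasure lborel ((\<lambda>x. (x, y)) -` ?E) \<partial>lborel)"
    unfolding fibre using lborel_pair.measurable_emeasure_Pair2[OF E'(2)]
    by (intro nn_integral_cmult) auto
  also have "\<dots> = ennreal s * emeasure lborel ?E"
    using lborel_pair.emeasure_pair_measure_alt2[OF E'(2)] by (simp add: lborel_prod)
  finally have "measure lborel E = s * measure lborel ?E"
    using s by (simp add: measure_def enn2real_mult)
  then show "measure lborel ?E = measure lborel E / s"
    using s by simp
qed

lemma borel_Times_closed:
  fixes A :: "'a::euclidean_space set" and B :: "'b::euclidean_space set"
  shows "closed A \<Longrightarrow> closed B \<Longrightarrow> A \<times> B \<in> sets borel"
  by (intro borel_closed closed_Times)

lemma unit_square_emeasure: "emeasure lborel ({0..1} \<times> {0..1} :: (real \<times> real) set) = 1"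
proof -
  have "emeasure (lborel \<Otimes>\<^sub>M lborel) ({0..1::real} \<times> {0..1::real}) = 1"
    by (subst lborel.emeasure_pair_measure_Times) auto
  then show ?thesis by (simp add: lborel_prod)
qed

lemma measure_subset_unit_square_le:
  fixes A :: "(real \<times> real) set"
  assumes "A \<subseteq> {0..1} \<times> {0..1}" "A \<in> sets borel"
  shows "measure lborel A \<le> 1"
proof -
  have le: "emeasure lborel A \<le> 1"
    using emeasure_mono[OF assms(1), of lborel] unit_square_emeasure
    by (simp add: borel_Times_closed)
  show ?thesis
    using enn2real_mono[OF le] by (simp add: measure_def)
qed

lemma measure_lborel_rectangle:
  fixes a b c d :: real
  assumes "a \<le> b" "c \<le> d"
  shows "measure lborel ({a..b} \<times> {c..d}) = (b - a) * (d - c)"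
proof -
  have "emeasure (lborel \<Otimes>\<^sub>M lborel) ({a..b} \<times> {c..d}) = ennreal (b - a) * ennreal (d - c)"
    using assms by (subst lborel.emeasure_pair_measure_Times) auto
  then show ?thesis
    using assms by (simp add: measure_def lborel_prod enn2real_mult)
qed

section \<open>Permutations acting on blocks\<close>

text \<open>
The numbers \<open>{1..q * m}\<close> are cut into \<open>q\<close> blocks of length \<open>m\<close>, counted from 0: the block
\<open>j\<close> goes to the block \<open>\<pi> j\<close>, and inside a block \<open>\<sigma>\<close> acts. The remaining
numbers are fixed, so that \<open>q * m\<close> may fall short of the size of the whole set.
\<close>

definition block_perm :: "nat \<Rightarrow> nat \<Rightarrow> (nat \<Rightarrow> nat) \<Rightarrow> (nat \<Rightarrow> nat) \<Rightarrow> nat \<Rightarrow> nat" where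
  "block_perm m q \<pi> \<sigma> x =
    (if x \<in> {1..q * m} then m * \<pi> ((x - 1) div m) + \<sigma> ((x - 1) mod m + 1) else x)"

lemma block_index_cases:
  fixes x m q :: nat
  assumes "x \<in> {1..q * m}"
  obtains j i where "j < q" "i \<in> {1..m}" "x = m * j + i"
proof
  have m: "m > 0" using assms by (cases m) auto
  show "(x - 1) div m < q"
    using assms m by (auto simp: less_mult_imp_div_less)
  show "(x - 1) mod m + 1 \<in> {1..m}"
    using m by (simp add: Suc_le_eq)
  show "x = m * ((x - 1) div m) + ((x - 1) mod m + 1)"
    using assms by simp
qed

lemma block_index_div_mod:
  fixes i j m :: nat
  assumes "i \<in> {1..m}"
  shows "(m * j + i - 1) div m = j" "(m * j + i - 1) mod m + 1 = i"
proof -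
  obtain i' where i': "i = Suc i'" "i' < m"
    using assms by (cases i) auto
  show "(m * j + i - 1) div m = j" "(m * j + i - 1) mod m + 1 = i"
    using i' by simp_all
qed

lemma block_index_in:
  fixes i j m q :: nat
  assumes "i \<in> {1..m}" "j < q"
  shows "m * j + i \<in> {1..q * m}"
proof -
  have "m * j + i \<le> m * Suc j" using assms by simp
  also have "\<dots> \<le> m * q" using assms by (intro mult_le_mono2) simp
  finally show ?thesis using assms by (simp add: mult.commute)
qed

lemma block_perm_block:
  assumes "i \<in> {1..m}" "j < q"
  shows "block_perm m q \<pi> \<sigma> (m * j + i) = m * \<pi> j + \<sigma> i"
  using block_index_in[OF assms] block_index_div_mod[OF assms(1)]
  by (simp add: block_perm_def)

lemma block_perm_permutes:
  assumes \<sigma>: "\<sigma> permutes {1..m}" and \<pi>: "\<pi> permutes {..<q}" and n: "q * m \<le> n"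
  shows "block_perm m q \<pi> \<sigma> permutes {1..n}"
proof -
  let ?\<tau> = "block_perm m q \<pi> \<sigma>"
  have \<sigma>_in: "\<sigma> i \<in> {1..m}" if "i \<in> {1..m}" for i
    using that permutes_in_image[OF \<sigma>] by blast
  have \<pi>_in: "\<pi> j < q" if "j < q" for j
    using that permutes_in_image[OF \<pi>] by blast
  have "?\<tau> permutes {1..q * m}"
  proof (rule inj_imp_permutes)
    show "inj_on ?\<tau> {1..q * m}"
    proof (rule inj_onI)
      fix x x' assume x: "x \<in> {1..q * m}" and x': "x' \<in> {1..q * m}" and eq: "?\<tau> x = ?\<tau> x'"
      obtain j i where ji: "j < q" "i \<in> {1..m}" "x = m * j + i"
        using x by (rule block_index_cases)
      obtain j' i' where ji': "j' < q" "i' \<in> {1..m}" "x' = m * j' + i'"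
        using x' by (rule block_index_cases)
      have eq: "m * \<pi> j + \<sigma> i = m * \<pi> j' + \<sigma> i'"
        using eq ji ji' by (simp add: block_perm_block)
      have "\<pi> j = \<pi> j'" "\<sigma> i = \<sigma> i'"
        using block_index_div_mod[OF \<sigma>_in[OF ji(2)], of "\<pi> j"]
          block_index_div_mod[OF \<sigma>_in[OF ji'(2)], of "\<pi> j'"]
        unfolding eq by auto
      then show "x = x'"
        using ji ji' permutes_inj[OF \<sigma>] permutes_inj[OF \<pi>] by (auto dest: injD)
    qed
    show "?\<tau> x \<in> {1..q * m}" if x: "x \<in> {1..q * m}" for x
    proof -
      obtain j i where ji: "j < q" "i \<in> {1..m}" "x = m * j + i"
        using x by (rule block_index_cases)
      then show ?thesis
        using block_index_in[OF \<sigma>_in \<pi>_in] by (simp only: block_perm_block)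
    qed
  qed (auto simp: block_perm_def)
  then show ?thesis
    by (rule permutes_subset) (use n in auto)
qed

text \<open>
The parallelograms from block \<open>j\<close> to block \<open>k\<close> lie in one large parallelogram. Straightening it
by the map on the right-hand side turns them into the parallelograms of size \<open>m\<close>.
\<close>

lemma parallelogram_in_block:
  assumes "m \<ge> 1"
  shows "(x, y) \<in> parallelogram n (m * j + i) (m * k + l) \<longleftrightarrow>
    (real n / real m * x - ((1 - y) * real j + y * real k), y) \<in> parallelogram m i l"
proof -
  have "real m * (real n / real m * x - ((1 - y) * real j + y * real k)) - (real l - real i) * y
      = real n * x - (real (m * k + l) - real (m * j + i)) * y - real m * real j"
    using assms by (simp add: field_simps)
  then show ?thesis
    by (auto simp: parallelogram_def)
qed

lemma perm_union_block_perm: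
  assumes m: "m \<ge> 1" and n: "q * m \<le> n"
  shows "perm_union n (block_perm m q \<pi> \<sigma>) =
    (\<Union>j<q. {(x, y). (real n / real m * x - ((1 - y) * real j + y * real (\<pi> j)), y) \<in> perm_union m \<sigma>})
    \<union> (\<Union>i\<in>{q * m<..n}. parallelogram n i i)"
proof -
  let ?\<tau> = "block_perm m q \<pi> \<sigma>"
  have blocks: "{1..q * m} = (\<Union>j<q. (\<lambda>i. m * j + i) ` {1..m})"
  proof (rule set_eqI)
    fix x
    have "x \<in> {1..q * m} \<longleftrightarrow> (\<exists>j<q. \<exists>i\<in>{1..m}. x = m * j + i)"
      using block_index_cases[of x q m] block_index_in by metis
    then show "x \<in> {1..q * m} \<longleftrightarrow> x \<in> (\<Union>j<q. (\<lambda>i. m * j + i) ` {1..m})"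
      by blast
  qed
  have "{1..n} = {1..q * m} \<union> {q * m<..n}" using n by auto
  then have "perm_union n ?\<tau> = (\<Union>x\<in>{1..q * m}. parallelogram n x (?\<tau> x))
      \<union> (\<Union>i\<in>{q * m<..n}. parallelogram n i (?\<tau> i))"
    by (simp add: perm_union_def UN_Un)
  also have "(\<Union>i\<in>{q * m<..n}. parallelogram n i (?\<tau> i)) = (\<Union>i\<in>{q * m<..n}. parallelogram n i i)"
    by (intro SUP_cong refl) (auto simp: block_perm_def)
  also have "(\<Union>x\<in>{1..q * m}. parallelogram n x (?\<tau> x)) =
      (\<Union>j<q. \<Union>i\<in>{1..m}. parallelogram n (m * j + i) (m * \<pi> j + \<sigma> i))"
  proof -
    have "(\<Union>x\<in>{1..q * m}. parallelogram n x (?\<tau> x)) =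
        (\<Union>j<q. \<Union>i\<in>{1..m}. parallelogram n (m * j + i) (?\<tau> (m * j + i)))"
      unfolding blocks by blast
    also have "\<dots> = (\<Union>j<q. \<Union>i\<in>{1..m}. parallelogram n (m * j + i) (m * \<pi> j + \<sigma> i))"
      by (intro SUP_cong refl) (simp only: block_perm_block lessThan_iff)
    finally show ?thesis .
  qed
  also have "\<dots> = (\<Union>j<q. {(x, y). (real n / real m * x - ((1 - y) * real j + y * real (\<pi> j)), y) \<in> perm_union m \<sigma>})"
    using parallelogram_in_block[OF m] by (fastforce simp: perm_union_def)
  finally show ?thesis .
qed

section \<open>Refinement lowers the area\<close>

lemma perm_union_subset_square:
  assumes \<sigma>: "\<sigma> permutes {1..n}"
  shows "perm_union n \<sigma> \<subseteq> {0..1} \<times> {0..1}"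
proof (clarsimp simp: perm_union_def)
  fix j x y assume j: "Suc 0 \<le> j" "j \<le> n" and xy: "(x, y) \<in> parallelogram n j (\<sigma> j)"
  have "\<sigma> j \<in> {1..n}" using permutes_in_image[OF \<sigma>, of j] j by simp
  then have s: "1 \<le> real (\<sigma> j)" "real (\<sigma> j) \<le> n" by auto
  have n: "real n > 0" and j': "1 \<le> real j" "real j \<le> n" using j by auto
  have y: "0 \<le> y" "y \<le> 1" using xy by (auto simp: parallelogram_def)
  have "0 \<le> (1 - y) * (real j - 1) + y * (real (\<sigma> j) - 1)"
    using y j' s by simp
  also have "\<dots> \<le> n * x"
    using xy by (simp add: parallelogram_def algebra_simps)
  finally have "0 \<le> x" using n by (simp add: zero_le_mult_iff)
  have "n * x \<le> (1 - y) * real j + y * real (\<sigma> j)"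
    using xy by (simp add: parallelogram_def algebra_simps)
  also have "\<dots> \<le> (1 - y) * n + y * n"
    using y j' s by (intro add_mono mult_left_mono) auto
  finally have "x \<le> 1" using n by (simp add: algebra_simps)
  show "0 \<le> x \<and> x \<le> 1 \<and> 0 \<le> y \<and> y \<le> 1"
    using \<open>0 \<le> x\<close> \<open>x \<le> 1\<close> y by simp
qed

lemma perm_union_borel:
  assumes "n \<ge> 1"
  shows "perm_union n \<sigma> \<in> sets borel"
proof -
  have "compact (perm_union n \<sigma>)"
    unfolding perm_union_def using assms by (intro compact_UN compact_parallelogram) auto
  then show ?thesis by (intro borel_closed compact_imp_closed)
qed

text \<open>
On the two horizontal sides the parallelograms of any permutation tile the unit interval, so no choice
makes them overlap, and the estimate of overlaps degenerates as the height approaches 0 or 1. The parts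
near the sides are therefore cut off and estimated trivially by their height.
\<close>

definition strip_area :: "real \<Rightarrow> nat \<Rightarrow> (nat \<Rightarrow> nat) \<Rightarrow> real" where
  "strip_area \<delta> n \<sigma> = measure lborel (perm_union n \<sigma> \<inter> UNIV \<times> {\<delta>..1 - \<delta>})"

lemma card_le_of_spread:
  fixes K :: "nat set" and d :: real
  assumes "finite K" "d > 0" and spread: "\<And>k l. k \<in> K \<Longrightarrow> l \<in> K \<Longrightarrow> (real k - real l) * d \<le> 1"
  shows "card K \<le> 1 / d + 1"
proof (cases "K = {}")
  case False
  have le: "Min K \<le> Max K" using assms(1) False by simp
  have "card K \<le> card {Min K..Max K}"
    using assms(1) by (intro card_mono) auto
  then have "real (card K) \<le> real (Max K) - real (Min K) + 1"
    using le by (simp add: of_nat_diff)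
  moreover have "real (Max K) - real (Min K) \<le> 1 / d"
    using spread[of "Max K" "Min K"] assms(1,2) False by (simp add: field_simps)
  ultimately show ?thesis by simp
qed (use assms in simp)

lemma strip_area_le_1:
  assumes "\<sigma> permutes {1..n}" "n \<ge> 1"
  shows "strip_area \<delta> n \<sigma> \<le> 1"
  unfolding strip_area_def
  using perm_union_subset_square[OF assms(1)] perm_union_borel[OF assms(2)]
  by (intro measure_subset_unit_square_le sets.Int) (auto intro!: borel_Times_closed)

text \<open>
The sets \<open>F j k\<close>, which are the given figure squeezed into the parallelogram from block \<open>j\<close> to
block \<open>k\<close>, have area \<open>a / N\<close> each. At height \<open>y\<close> and for fixed \<open>j\<close>, the figures
\<open>F j k\<close> lie in intervals of length \<open>1 / N\<close> whose positions advance by \<open>y / N\<close> with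
\<open>k\<close>; as \<open>y \<ge> \<delta>\<close>, a point is in at most \<open>1 / \<delta> + 1 \<le> 2 / \<delta>\<close> of
them. For fixed \<open>k\<close> the step is \<open>(1 - y) / N\<close> instead. So the averaging lemma applies with
\<open>D = 2 / \<delta>\<close>.
\<close>

lemma exists_refinement_smaller_strip_area:
  assumes \<delta>: "0 < \<delta>" "\<delta> \<le> 1" and N: "N \<ge> 2" and m: "m \<ge> 1" and \<sigma>: "\<sigma> permutes {1..m}"
  defines "a \<equiv> strip_area \<delta> m \<sigma>"
  shows "\<exists>\<tau>. \<tau> permutes {1..N * m} \<and>
    strip_area \<delta> (N * m) \<tau> \<le> a - (a\<^sup>2 - 4 * a / (\<delta> * N)) / N"
proof -
  define E where "E = perm_union m \<sigma> \<inter> UNIV \<times> {\<delta>..1 - \<delta>}"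
  define Q where "Q = ({0..1} \<times> {0..1} :: (real \<times> real) set)"
  \<comment> \<open>All copies lie in the unit square, which has the total mass 1 that averaging needs.\<close>
  define M where "M = restrict_space lborel Q"
  define F where "F j k = {(x, y). (real N * x - ((1 - y) * real j + y * real k), y) \<in> E}"
    for j k :: nat
  have Q[measurable]: "Q \<in> sets borel"
    unfolding Q_def by (intro borel_closed closed_Times) auto
  have E[measurable]: "E \<in> sets borel"
    unfolding E_def using perm_union_borel[OF m] by (intro sets.Int borel_Times_closed) auto
  have E_in: "0 \<le> x \<and> x \<le> 1 \<and> \<delta> \<le> y \<and> y \<le> 1 - \<delta>" if "(x, y) \<in> E" for x y
    using that perm_union_subset_square[OF \<sigma>] by (auto simp: E_def)
  have F_measure: "F j k \<in> sets borel" "measure lborel (F j k) = a / N" for j k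
    using measure_fibrewise_affine[OF E, of "real N" "\<lambda>y. (1 - y) * real j + y * real k"] N
    by (simp_all add: F_def a_def strip_area_def E_def)
  have FQ: "F j k \<subseteq> Q" if jk: "j < N" "k < N" for j k
  proof
    fix p assume p: "p \<in> F j k"
    obtain x y where xy_def: "p = (x, y)" by (cases p)
    have "(real N * x - ((1 - y) * real j + y * real k), y) \<in> E"
      using p by (simp add: F_def xy_def)
    from E_in[OF this] have xy: "0 \<le> N * x - ((1 - y) * real j + y * real k)"
      "N * x - ((1 - y) * real j + y * real k) \<le> 1" "0 \<le> y" "y \<le> 1" using \<delta> by auto
    have jk': "real j \<le> real N - 1" "real k \<le> real N - 1"
      using jk by auto
    have "0 \<le> (1 - y) * real j + y * real k" using xy by simp
    then have "0 \<le> N * x" using xy by linarith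
    then have "0 \<le> x" using N by (simp add: zero_le_mult_iff)
    have "(1 - y) * real j + y * real k \<le> (1 - y) * (real N - 1) + y * (real N - 1)"
      using xy jk' by (intro add_mono mult_left_mono) auto
    also have "\<dots> = real N - 1" by (simp add: algebra_simps)
    finally have "real N * x \<le> real N * 1" using xy by simp
    then have "x \<le> 1" using N by (subst (asm) mult_le_cancel_left_pos) auto
    show "p \<in> Q"
      using \<open>0 \<le> x\<close> \<open>x \<le> 1\<close> xy by (simp add: Q_def xy_def)
  qed
  have M_space: "space M = Q" by (simp add: M_def space_restrict_space)
  have M_measure: "A \<in> sets M" "measure M A = measure lborel A" if "A \<subseteq> Q" "A \<in> sets borel" for A
    using that by (simp_all add: M_def sets_restrict_space_iff measure_restrict_space)
  have M_emeasure: "emeasure M (space M) = 1"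
    using unit_square_emeasure by (simp add: M_space M_def emeasure_restrict_space Q_def[symmetric])
  have finM: "finite_measure M"
    by (rule finite_measureI) (simp add: M_emeasure)
  have spread: "card K \<le> 2 / \<delta>"
    if K: "finite K" and d: "\<delta> \<le> d" "d \<le> 1" and l: "\<And>k. k \<in> K \<Longrightarrow> b - 1 \<le> real k * d \<and> real k * d \<le> b"
    for K :: "nat set" and b d :: real
  proof -
    have "card K \<le> 1 / d + 1"
    proof (rule card_le_of_spread[OF K])
      fix k k' assume "k \<in> K" "k' \<in> K"
      from l[OF this(1)] l[OF this(2)] show "(real k - real k') * d \<le> 1"
        by (simp add: algebra_simps)
    qed (use d \<delta> in simp)
    also have "\<dots> \<le> 1 / \<delta> + 1 / \<delta>"
      using d \<delta> by (intro add_mono divide_left_mono) auto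
    finally show ?thesis by simp
  qed
  have "\<exists>\<pi>. \<pi> permutes {..<N} \<and> measure M (\<Union>j\<in>{..<N}. F j (\<pi> j))
      \<le> a - (a\<^sup>2 - 2 * (2 / \<delta>) * a / card {..<N}) / card {..<N}"
  proof (rule exists_permutation_small_union[OF finM])
    show "measure M (space M) = 1" using M_emeasure by (simp add: measure_def)
    show "card {..<N} \<ge> 2" using N by simp
    show "F j k \<in> sets M" "measure M (F j k) = a / card {..<N}"
      if "j \<in> {..<N}" "k \<in> {..<N}" for j k
      using that M_measure[OF FQ F_measure(1), of j k] F_measure(2) by auto
    show "card {k\<in>{..<N}. p \<in> F j k} \<le> 2 / \<delta>" if "j \<in> {..<N}" for j p
    proof (cases p)
      case (Pair x y)
      have in_E: "(real N * x - ((1 - y) * real j + y * real k), y) \<in> E"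
        if "p \<in> F j k" for k
        using that by (simp add: F_def Pair)
      show ?thesis
      proof (cases "{k\<in>{..<N}. p \<in> F j k} = {}")
        case False
        then have y: "\<delta> \<le> y" "y \<le> 1" using in_E E_in \<delta> by fastforce+
        show ?thesis
        proof (rule spread[OF _ y, where b = "real N * x - (1 - y) * real j"])
          fix k assume "k \<in> {k\<in>{..<N}. p \<in> F j k}"
          from E_in[OF in_E] this
          have "0 \<le> N * x - ((1 - y) * j + y * k)" "N * x - ((1 - y) * j + y * k) \<le> 1" by auto
          then show "real N * x - (1 - y) * real j - 1 \<le> real k * y \<and>
              real k * y \<le> real N * x - (1 - y) * real j"
            by (simp add: mult.commute)
        qed simp
      next
        case True
        show ?thesis unfolding True using \<delta> by simp
      qed
    qed
    show "card {j\<in>{..<N}. p \<in> F j k} \<le> 2 / \<delta>" if "k \<in> {..<N}" for k p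
    proof (cases p)
      case (Pair x y)
      have in_E: "(real N * x - ((1 - y) * real j + y * real k), y) \<in> E"
        if "p \<in> F j k" for j
        using that by (simp add: F_def Pair)
      show ?thesis
      proof (cases "{j\<in>{..<N}. p \<in> F j k} = {}")
        case False
        then have y: "\<delta> \<le> 1 - y" "1 - y \<le> 1" using in_E E_in \<delta> by fastforce+
        show ?thesis
        proof (rule spread[OF _ y, where b = "real N * x - y * real k"])
          fix j assume "j \<in> {j\<in>{..<N}. p \<in> F j k}"
          from E_in[OF in_E] this
          have "0 \<le> N * x - ((1 - y) * j + y * k)" "N * x - ((1 - y) * j + y * k) \<le> 1" by auto
          then show "real N * x - y * real k - 1 \<le> real j * (1 - y) \<and>
              real j * (1 - y) \<le> real N * x - y * real k"
            by (simp add: mult.commute)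
        qed simp
      next
        case True
        show ?thesis unfolding True using \<delta> by simp
      qed
    qed
  qed simp
  then obtain \<pi> where \<pi>: "\<pi> permutes {..<N}"
    and small: "measure M (\<Union>j<N. F j (\<pi> j)) \<le> a - (a\<^sup>2 - 4 * a / (\<delta> * N)) / N"
    by auto
  have \<pi>_in: "\<pi> j < N" if "j < N" for j
    using permutes_in_image[OF \<pi>, of j] that by simp
  let ?\<tau> = "block_perm m N \<pi> \<sigma>"
  have "perm_union (N * m) ?\<tau> \<inter> UNIV \<times> {\<delta>..1 - \<delta>} = (\<Union>j<N. F j (\<pi> j))"
    using m by (subst perm_union_block_perm) (auto simp: F_def E_def)
  then have "strip_area \<delta> (N * m) ?\<tau> = measure M (\<Union>j<N. F j (\<pi> j))"
    unfolding strip_area_def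
  proof (simp only:, intro M_measure(2)[symmetric])
    show "(\<Union>j<N. F j (\<pi> j)) \<subseteq> Q" using FQ \<pi>_in by blast
    show "(\<Union>j<N. F j (\<pi> j)) \<in> sets borel"
      using F_measure(1) by (intro sets.finite_UN) auto
  qed
  moreover have "?\<tau> permutes {1..N * m}"
    using block_perm_permutes[OF \<sigma> \<pi> order_refl] .
  ultimately show ?thesis
    using small by metis
qed

section \<open>Iteration and arbitrary sizes\<close>

lemma measure_perm_union_le_strip_area:
  assumes n: "n \<ge> 1" and \<sigma>: "\<sigma> permutes {1..n}" and \<delta>: "0 \<le> \<delta>"
  shows "measure lborel (perm_union n \<sigma>) \<le> strip_area \<delta> n \<sigma> + 2 * \<delta>"
proof -
  let ?S = "perm_union n \<sigma> \<inter> UNIV \<times> {\<delta>..1 - \<delta>}"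
  let ?L = "{0..1} \<times> {0..\<delta>} :: (real \<times> real) set" and ?U = "{0..1} \<times> {1 - \<delta>..1} :: (real \<times> real) set"
  have sets: "?S \<in> sets lborel" "?L \<in> sets lborel" "?U \<in> sets lborel"
    using perm_union_borel[OF n]
    by (auto intro!: borel_Times_closed)
  have "perm_union n \<sigma> \<subseteq> ?S \<union> ?L \<union> ?U"
    using perm_union_subset_square[OF \<sigma>] by auto
  moreover have "emeasure lborel (?S \<union> ?L \<union> ?U) < \<infinity>"
  proof -
    have "bounded (?S \<union> ?L \<union> ?U)"
      using perm_union_subset_square[OF \<sigma>]
      by (intro bounded_subset[OF bounded_Times[of "{0..1}" "{-\<delta>..1+\<delta>}"]]) (use \<delta> in auto)
    then show ?thesis by (rule emeasure_bounded_finite)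
  qed
  ultimately have "measure lborel (perm_union n \<sigma>) \<le> measure lborel (?S \<union> ?L \<union> ?U)"
    using sets perm_union_borel[OF n] by (intro measure_mono_fmeasurable) (auto simp: fmeasurable_def)
  also have "\<dots> \<le> measure lborel (?S \<union> ?L) + measure lborel ?U"
    using sets by (intro measure_Un_le) auto
  also have "\<dots> \<le> measure lborel ?S + measure lborel ?L + measure lborel ?U"
    using sets by (intro add_right_mono measure_Un_le) auto
  also have "\<dots> = strip_area \<delta> n \<sigma> + 2 * \<delta>"
    using \<delta> by (simp add: measure_lborel_rectangle strip_area_def)
  finally show ?thesis .
qed

text \<open>
With \<open>N\<close> about \<open>8 / \<epsilon>\<^sup>2\<close> the error term of a refinement step is at most half of its gain as
long as the area is at least \<open>\<epsilon>\<close>; such a step lowers the area by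
\<open>d = \<epsilon>\<^sup>2 / (2 * N)\<close>. Starting from area at most 1, about \<open>1 / d\<close> steps
suffice. That is of order \<open>\<epsilon> powr -4\<close> steps, each multiplying the size by
\<open>N\<close>, which gives the bound for the logarithm of the size with the crude estimate
\<open>ln N \<le> N\<close>.
\<close>

lemma exists_small_strip_area:
  assumes \<epsilon>: "0 < \<epsilon>" "\<epsilon> \<le> 1"
  shows "\<exists>n \<sigma>. n \<ge> 1 \<and> \<sigma> permutes {1..n} \<and> ln (real n) \<le> 180 / \<epsilon> ^ 6 \<and> strip_area \<epsilon> n \<sigma> < \<epsilon>"
proof -
  define N where "N = nat \<lceil>8 / \<epsilon>\<^sup>2\<rceil>"
  define d where "d = \<epsilon>\<^sup>2 / (2 * N)"
  define M where "M = nat \<lceil>2 * N / \<epsilon>\<^sup>2\<rceil>"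
  have e2: "1 \<le> 1 / \<epsilon>\<^sup>2" "1 \<le> 1 / \<epsilon> ^ 4"
    using \<epsilon> by (simp_all add: power_le_one)
  have ceil: "real (nat \<lceil>r\<rceil>) \<le> r + 1" if "r \<ge> 0" for r :: real
    using that of_int_ceiling_le_add_one[of r] by simp
  have N: "8 / \<epsilon>\<^sup>2 \<le> N" "N \<le> 9 / \<epsilon>\<^sup>2"
  proof -
    show "8 / \<epsilon>\<^sup>2 \<le> N" unfolding N_def by (rule real_nat_ceiling_ge)
    have "N \<le> 8 / \<epsilon>\<^sup>2 + 1"
      unfolding N_def by (rule ceil) simp
    then show "N \<le> 9 / \<epsilon>\<^sup>2" using e2 by simp
  qed
  have N8: "real N \<ge> 8" using N(1) e2 by simp
  have M: "2 * N / \<epsilon>\<^sup>2 \<le> M" "M \<le> 2 * N / \<epsilon>\<^sup>2 + 1"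
    unfolding M_def by (rule real_nat_ceiling_ge) (rule ceil, simp)
  have iterate: "(\<exists>k\<le>m. \<exists>\<sigma>. \<sigma> permutes {1..N ^ k} \<and> strip_area \<epsilon> (N ^ k) \<sigma> < \<epsilon>) \<or>
    (\<exists>\<sigma>. \<sigma> permutes {1..N ^ m} \<and> strip_area \<epsilon> (N ^ m) \<sigma> \<le> 1 - m * d)" for m
  proof (induction m)
    case 0
    show ?case
      using strip_area_le_1[of id "N ^ 0" \<epsilon>] permutes_id[of "{1..N ^ 0}"] by auto
  next
    case (Suc m)
    show ?case
    proof (cases "\<exists>k\<le>Suc m. \<exists>\<sigma>. \<sigma> permutes {1..N ^ k} \<and> strip_area \<epsilon> (N ^ k) \<sigma> < \<epsilon>")
      case False
      with Suc obtain \<sigma> where \<sigma>: "\<sigma> permutes {1..N ^ m}" "strip_area \<epsilon> (N ^ m) \<sigma> \<le> 1 - m * d"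
        by (meson le_SucI)
      define a where "a = strip_area \<epsilon> (N ^ m) \<sigma>"
      have a: "a \<ge> \<epsilon>" using False \<sigma>(1) by (force simp: a_def not_less)
      obtain \<tau> where \<tau>: "\<tau> permutes {1..N * N ^ m}"
        "strip_area \<epsilon> (N * N ^ m) \<tau> \<le> a - (a\<^sup>2 - 4 * a / (\<epsilon> * N)) / N"
        using exists_refinement_smaller_strip_area[OF \<epsilon>, of N "N ^ m" \<sigma>] \<sigma> N8
        by (auto simp: a_def)
      have "4 * a / (\<epsilon> * N) \<le> a * \<epsilon> / 2"
        using N(1) N8 \<epsilon> a by (simp add: field_simps power2_eq_square)
      also have "\<dots> \<le> a * a / 2"
        using a \<epsilon> by (intro divide_right_mono mult_left_mono) auto
      finally have "a\<^sup>2 - 4 * a / (\<epsilon> * N) \<ge> a\<^sup>2 / 2"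
        by (simp add: power2_eq_square)
      moreover have "a\<^sup>2 / 2 \<ge> \<epsilon>\<^sup>2 / 2"
        using a \<epsilon> by (intro divide_right_mono power_mono) auto
      ultimately have "(a\<^sup>2 - 4 * a / (\<epsilon> * N)) / N \<ge> \<epsilon>\<^sup>2 / 2 / N"
        by (intro divide_right_mono) auto
      then have "strip_area \<epsilon> (N * N ^ m) \<tau> \<le> 1 - m * d - d"
        using \<tau>(2) \<sigma>(2) by (simp add: a_def d_def)
      then show ?thesis
        using \<tau>(1) by (intro disjI2 exI[of _ \<tau>]) (simp add: algebra_simps)
    qed simp
  qed
  have "M * d \<ge> 1"
    using M(1) N8 \<epsilon> by (simp add: d_def field_simps)
  then obtain k \<sigma> where k: "k \<le> M" "\<sigma> permutes {1..N ^ k}" "strip_area \<epsilon> (N ^ k) \<sigma> < \<epsilon>"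
    using iterate[of M] \<epsilon> by force
  have "ln (real (N ^ k)) = k * ln N"
    using N8 by (simp add: ln_realpow)
  also have "\<dots> \<le> real M * real N"
    using k(1) N8 ln_le_minus_one[of "real N"] by (intro mult_mono) auto
  also have "\<dots> \<le> (19 / \<epsilon> ^ 4) * (9 / \<epsilon>\<^sup>2)"
  proof (intro mult_mono N)
    have "2 * N / \<epsilon>\<^sup>2 \<le> 2 * (9 / \<epsilon>\<^sup>2) / \<epsilon>\<^sup>2"
      using N by (intro divide_right_mono mult_left_mono) auto
    also have "\<dots> = 18 / \<epsilon> ^ 4" by (simp add: power4_eq_xxxx power2_eq_square)
    finally show "M \<le> 19 / \<epsilon> ^ 4" using M(2) e2 by simp
  qed (use \<epsilon> in auto)
  also have "\<dots> = 171 / \<epsilon> ^ 6"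
    by (simp add: power_numeral_reduce)
  also have "\<dots> \<le> 180 / \<epsilon> ^ 6"
    using \<epsilon> by (intro divide_right_mono) auto
  finally have "ln (real (N ^ k)) \<le> 180 / \<epsilon> ^ 6" .
  moreover have "N ^ k \<ge> 1" using N8 by simp
  ultimately show ?thesis using k by blast
qed

lemma alpha_le:
  assumes "n \<ge> 1" "\<sigma> permutes {1..n}"
  shows "alpha n \<le> measure lborel (perm_union n \<sigma>)"
proof -
  have "alpha n \<le> measure lebesgue (perm_union n \<sigma>)"
    unfolding alpha_def using assms(2) finite_perms by (intro Min_le) auto
  then show ?thesis
    using perm_union_borel[OF assms(1)] by simp
qed

text \<open>
Blocks of size \<open>m\<close>, each with a copy of the figure of \<open>\<sigma>\<close> squeezed into its own upright
rectangle, use all but fewer than \<open>m\<close> of the indices; a fixed index costs a rectangle of area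
\<open>1 / n\<close>.
\<close>

lemma alpha_le_of_smaller_perm:
  assumes m: "m \<ge> 1" "m \<le> n" and \<sigma>: "\<sigma> permutes {1..m}"
  shows "alpha n \<le> measure lborel (perm_union m \<sigma>) + m / n"
proof -
  define q where "q = n div m"
  define A where "A = measure lborel (perm_union m \<sigma>)"
  let ?\<tau> = "block_perm m q id \<sigma>"
  let ?B = "\<lambda>j. {(x, y). (real n / real m * x - ((1 - y) * real j + y * real j), y) \<in> perm_union m \<sigma>}"
  let ?R = "\<lambda>i. parallelogram n i i"
  have n: "n \<ge> 1" using m by simp
  have qm: "q * m \<le> n" by (simp add: q_def)
  have rem: "n - q * m \<le> m"
    using m by (simp add: q_def modulo_nat_def[symmetric] minus_div_mult_eq_mod less_imp_le)
  have B: "?B j \<in> sets lborel" "measure lborel (?B j) = A / (real n / real m)" for j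
    using measure_fibrewise_affine[OF perm_union_borel[OF m(1)], of "real n / real m" "\<lambda>y. (1 - y) * real j + y * real j" \<sigma>]
      m by (simp_all add: A_def)
  have R: "?R i = {(real i - 1) / n..real i / n} \<times> {0..1}" for i
    using n by (auto simp: parallelogram_def field_simps)
  have R_sets: "?R i \<in> sets lborel" for i
    using compact_parallelogram[OF n, of i i] by (simp add: borel_closed compact_imp_closed)
  have R_meas: "measure lborel (?R i) = 1 / n" for i
    unfolding R using n by (subst measure_lborel_rectangle) (auto simp: field_simps)
  have "?\<tau> permutes {1..n}"
    using block_perm_permutes[OF \<sigma> permutes_id qm] .
  then have "alpha n \<le> measure lborel (perm_union n ?\<tau>)"
    by (rule alpha_le[OF n])
  also have "\<dots> = measure lborel ((\<Union>j<q. ?B j) \<union> (\<Union>i\<in>{q * m<..n}. ?R i))"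
    by (simp add: perm_union_block_perm[OF m(1) qm])
  also have "\<dots> \<le> measure lborel (\<Union>j<q. ?B j) + measure lborel (\<Union>i\<in>{q * m<..n}. ?R i)"
    using B(1) R_sets by (intro measure_Un_le sets.finite_UN) auto
  also have "\<dots> \<le> (\<Sum>j<q. measure lborel (?B j)) + (\<Sum>i\<in>{q * m<..n}. measure lborel (?R i))"
    using B(1) R_sets by (intro add_mono measure_UNION_le) auto
  also have "\<dots> = q * (A / (real n / real m)) + (n - q * m) * (1 / n)"
    unfolding B(2) R_meas by simp
  also have "\<dots> \<le> A + m / n"
  proof (rule add_mono)
    have "real q * real m \<le> n" using qm by (simp flip: of_nat_mult)
    then have "A * (real q * real m) \<le> A * n"
      by (intro mult_left_mono) (auto simp: A_def)
    then show "q * (A / (real n / real m)) \<le> A"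
      using n by (simp add: field_simps)
    show "(n - q * m) * (1 / n) \<le> m / n"
      using rem n by (simp add: divide_right_mono del: of_nat_diff)
  qed
  finally show ?thesis by (simp add: A_def)
qed

theorem theorem4:
  shows "\<exists>C p :: real. C > 0 \<and> p > 0 \<and>
           (\<forall>n::nat. n \<ge> 2 \<longrightarrow> alpha n < C / (ln (real n)) powr p)"
proof (intro exI conjI allI impI)
  let ?C = "5 * 360 powr (1 / 6) :: real"
  show "?C > 0" "(1 / 6 :: real) > 0" by simp_all
  fix n :: nat assume n: "n \<ge> 2"
  define L where "L = ln (real n)"
  \<comment> \<open>The choice of \<open>\<epsilon>\<close> makes \<open>180 / \<epsilon> ^ 6 = L / 2\<close>, so that a permutation of size
      \<open>m \<le> sqrt n\<close> is good enough and the remainder \<open>m / n\<close> is negligible.\<close>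
  define \<epsilon> where "\<epsilon> = (360 / L) powr (1 / 6)"
  have L: "L > 0" using n by (simp add: L_def)
  have \<epsilon>: "\<epsilon> > 0" using L by (simp add: \<epsilon>_def)
  have "alpha n \<le> 4 * \<epsilon>"
  proof (cases "\<epsilon> \<le> 1")
    case True
    have \<epsilon>6: "\<epsilon> ^ 6 = 360 / L"
      using L \<epsilon> by (simp add: \<epsilon>_def powr_powr flip: powr_realpow)
    obtain m \<sigma> where m: "m \<ge> 1" and \<sigma>: "\<sigma> permutes {1..m}" and ln_m: "ln (real m) \<le> 180 / \<epsilon> ^ 6"
      and small: "strip_area \<epsilon> m \<sigma> < \<epsilon>"
      using exists_small_strip_area[OF \<epsilon> True] by blast
    have ln_m: "ln (real m) \<le> L / 2" using ln_m L by (simp add: \<epsilon>6)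
    then have "ln (real m) \<le> ln (real n)" using L by (simp add: L_def)
    then have mn: "m \<le> n" using m n by (simp add: ln_le_cancel_iff)
    have "\<epsilon> ^ 6 \<le> \<epsilon>"
      using \<epsilon> True power_decreasing[of 1 6 \<epsilon>] by simp
    then have L\<epsilon>: "360 / L \<le> \<epsilon>" by (simp add: \<epsilon>6)
    have "real m / real n = exp (ln (real m) - L)"
      using m n by (simp add: L_def exp_diff)
    also have "\<dots> \<le> exp (- (L / 2))" using ln_m by simp
    also have "\<dots> \<le> 1 / (L / 2)"
      using L exp_ge_add_one_self[of "L / 2"] by (simp add: exp_minus field_simps)
    also have "\<dots> \<le> 360 / L" using L by (simp add: field_simps)
    finally have "real m / real n \<le> \<epsilon>" using L\<epsilon> by simp
    moreover have "measure lborel (perm_union m \<sigma>) \<le> 3 * \<epsilon>"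
      using measure_perm_union_le_strip_area[OF m \<sigma>, of \<epsilon>] small \<epsilon> by simp
    ultimately show ?thesis
      using alpha_le_of_smaller_perm[OF m mn \<sigma>] by simp
  next
    case False
    have "alpha n \<le> measure lborel (perm_union n id)"
      using n by (intro alpha_le permutes_id) auto
    also have "\<dots> \<le> 1"
      using n by (intro measure_subset_unit_square_le perm_union_subset_square perm_union_borel permutes_id) auto
    finally show ?thesis using False by simp
  qed
  also have "4 * \<epsilon> < 5 * \<epsilon>" using \<epsilon> by simp
  also have "5 * \<epsilon> = ?C / L powr (1 / 6)"
    using L by (simp add: \<epsilon>_def powr_divide)
  finally show "alpha n < ?C / ln (real n) powr (1 / 6)" by (simp add: L_def)
qed

end
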